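(* Let $F$ be a field and let $Q$ be a finite quiver. Then the path algebra $FQ$ is a PI algebra if and only if every vertex of $Q$ lies in at most one oriented cycle of $Q$.
   Context: A finite quiver $Q=(Q_0,Q_1,s,t)$ consists of a finite set $Q_0$ of vertices, a finite set $Q_1$ of arrows and maps $s,t:Q_1\to Q_0$ giving the starting and terminal vertex of each arrow. A path of length $r\ge 1$ is a sequence $p=\alpha_1\alpha_2\cdots\alpha_r$ of arrows with $t(\alpha_i)=s(\alpha_{i+1})$ for $1\le i\le r-1$; put $s(p)=s(\alpha_1)$, $t(p)=t(\alpha_r)$. Its support is the subquiver whose arrows are $\alpha_1,\dots,\alpha_r$ and whose vertices are their starting and terminal vertices. For each vertex $v$ there is also a lazy path $e_v$ of length $0$ from $v$ to $v$. A closed path is a path $c$ (of length $\geq 1$) with $s(c)=t(c)$; an oriented cycle of $Q$ is the support of a closed path of $Q$. The path algebra $FQ$ is the $F$-vector space with basis all paths in $Q$ (including lazy paths), with multiplication given on paths by concatenation $pq$ if $t(p)=s(q)$ and $0$ otherwise. An associative $F$-algebra $A$ is PI if there is a nonzero non-commutative polynomial $f\in F\langle x_1,\dots,x_N\rangle$ (for some $N$), an element of the free associative algebra, such that $f(a_1,\dots,a_N)=0$ for all $a_1,\dots,a_N\in A$. *)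

theory Defs
  imports
    "Graph_Theory.Arc_Walk"
    "HOL-Algebra.Module"
    "HOL-Library.Poly_Mapping"
begin

section \<open>Associative algebras and polynomial identities\<close>

abbreviation field_ring :: "'f::field ring" where
  "field_ring \<equiv> \<lparr>carrier = UNIV, mult = (*), one = 1, zero = 0, add = (+)\<rparr>"

text \<open>The locale \<open>algebra\<close> of HOL-Algebra forces the algebra itself to be commutative, so it
  cannot be used here. Algebras are unital; the zero ring is allowed.\<close>

locale assoc_algebra = ring A + module field_ring A
  for A :: "('f::field, 'a) module" (structure) +
  assumes smult_mult_left: "x \<in> carrier A \<Longrightarrow> y \<in> carrier A \<Longrightarrow> (c \<odot> x) \<otimes> y = c \<odot> (x \<otimes> y)"
    and smult_mult_right: "x \<in> carrier A \<Longrightarrow> y \<in> carrier A \<Longrightarrow> x \<otimes> (c \<odot> y) = c \<odot> (x \<otimes> y)"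

text \<open>The free algebra on \<open>N\<close> generators: a word \<open>[i\<^sub>1, \<dots>, i\<^sub>k]\<close> with letters below \<open>N\<close>
  is the monomial \<open>x\<^bsub>i\<^sub>1\<^esub> \<cdots> x\<^bsub>i\<^sub>k\<^esub>\<close>, the variables being numbered from 0; the empty word is 1.\<close>

definition nc_polynomials :: "nat \<Rightarrow> (nat list \<Rightarrow>\<^sub>0 'f::field) set" where
  "nc_polynomials N = {f. \<forall>w \<in> Poly_Mapping.keys f. set w \<subseteq> {..<N}}"

definition nc_eval :: "('f::field, 'a) module \<Rightarrow> (nat list \<Rightarrow>\<^sub>0 'f) \<Rightarrow> (nat \<Rightarrow> 'a) \<Rightarrow> 'a" where
  "nc_eval A f a =
     (\<Oplus>\<^bsub>A\<^esub>w \<in> Poly_Mapping.keys f.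
        Poly_Mapping.lookup f w \<odot>\<^bsub>A\<^esub> foldr (\<lambda>i y. a i \<otimes>\<^bsub>A\<^esub> y) w \<one>\<^bsub>A\<^esub>)"

definition PI_algebra :: "('f::field, 'a) module \<Rightarrow> bool" where
  "PI_algebra A \<longleftrightarrow> assoc_algebra A \<and>
     (\<exists>N. \<exists>f \<in> nc_polynomials N. f \<noteq> 0 \<and>
        (\<forall>a. (\<forall>i<N. a i \<in> carrier A) \<longrightarrow> nc_eval A f a = \<zero>\<^bsub>A\<^esub>))"


section \<open>Path algebras\<close>

text \<open>Quivers are the multidigraphs of \<open>Graph_Theory\<close> (loops and parallel arcs allowed).
  A path is a triple of source, list of arrows and target; \<open>(v, [], v)\<close> is the lazy path at \<open>v\<close>.\<close>

type_synonym ('v, 'e) qpath = "'v \<times> 'e list \<times> 'v"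

definition qpaths :: "('v, 'e) pre_digraph \<Rightarrow> ('v, 'e) qpath set" where
  "qpaths Q = {(u, p, v). pre_digraph.awalk Q u p v}"

fun basis_mult :: "('v, 'e) qpath \<Rightarrow> ('v, 'e) qpath \<Rightarrow> ('v, 'e) qpath \<Rightarrow>\<^sub>0 'f::field" where
  "basis_mult (u, p, v) (u', p', v') = (if v = u' then Poly_Mapping.single (u, p @ p', v') 1 else 0)"

definition scale :: "'f::field \<Rightarrow> ('k \<Rightarrow>\<^sub>0 'f) \<Rightarrow> 'k \<Rightarrow>\<^sub>0 'f" where
  "scale c f = Poly_Mapping.map ((*) c) f"

definition path_mult ::
  "(('v, 'e) qpath \<Rightarrow>\<^sub>0 'f::field) \<Rightarrow> (('v, 'e) qpath \<Rightarrow>\<^sub>0 'f) \<Rightarrow> ('v, 'e) qpath \<Rightarrow>\<^sub>0 'f" where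
  "path_mult f g =
     (\<Sum>p \<in> Poly_Mapping.keys f. \<Sum>q \<in> Poly_Mapping.keys g.
        scale (Poly_Mapping.lookup f p * Poly_Mapping.lookup g q) (basis_mult p q))"

definition path_algebra ::
  "('v, 'e) pre_digraph \<Rightarrow> ('f::field, ('v, 'e) qpath \<Rightarrow>\<^sub>0 'f) module" where
  "path_algebra Q =
     \<lparr>carrier = {f. Poly_Mapping.keys f \<subseteq> qpaths Q},
      mult = path_mult,
      one = (\<Sum>v \<in> verts Q. Poly_Mapping.single (v, [], v) 1),
      zero = 0,
      add = (+),
      smult = scale\<rparr>"


section \<open>Oriented cycles\<close>

definition path_support :: "('v, 'e) pre_digraph \<Rightarrow> 'e list \<Rightarrow> ('v, 'e) pre_digraph" where
  "path_support Q p =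
     \<lparr>verts = tail Q ` set p \<union> head Q ` set p, arcs = set p, tail = tail Q, head = head Q\<rparr>"

definition oriented_cycle :: "('v, 'e) pre_digraph \<Rightarrow> ('v, 'e) pre_digraph \<Rightarrow> bool" where
  "oriented_cycle Q C \<longleftrightarrow>
     (\<exists>v p. pre_digraph.awalk Q v p v \<and> p \<noteq> [] \<and> C = path_support Q p)"


section \<open>The path algebra is an associative algebra\<close>

lemma lookup_scale [simp]: "Poly_Mapping.lookup (scale c f) k = c * Poly_Mapping.lookup f k"
  by (simp add: scale_def Poly_Mapping.map.rep_eq when_def)

lemma scale_simps [simp]:
  "scale c 0 = 0" "scale 0 f = 0" "scale 1 f = f" "scale a (scale b f) = scale (a * b) f"
  "scale c (Poly_Mapping.single k a) = Poly_Mapping.single k (c * a)"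
  by (auto intro!: poly_mapping_eqI simp: lookup_single when_def)

lemma scale_add:
  "scale c (f + g) = scale c f + scale c g" "scale (a + b) f = scale a f + scale b f"
  by (auto intro!: poly_mapping_eqI simp: lookup_add algebra_simps)

lemma scale_sum: "scale c (\<Sum>i\<in>I. f i) = (\<Sum>i\<in>I. scale c (f i))"
  by (rule poly_mapping_eqI) (simp add: lookup_sum sum_distrib_left)

lemma keys_scale: "Poly_Mapping.keys (scale c f) \<subseteq> Poly_Mapping.keys f"
  by (auto simp: in_keys_iff)

lemma path_mult_superset:
  assumes "finite S" "Poly_Mapping.keys f \<subseteq> S" "finite T" "Poly_Mapping.keys g \<subseteq> T"
  shows "path_mult f g =
    (\<Sum>p\<in>S. \<Sum>q\<in>T. scale (Poly_Mapping.lookup f p * Poly_Mapping.lookup g q) (basis_mult p q))"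
proof -
  have "(\<Sum>q\<in>Poly_Mapping.keys g. scale (Poly_Mapping.lookup f p * Poly_Mapping.lookup g q) (basis_mult p q))
      = (\<Sum>q\<in>T. scale (Poly_Mapping.lookup f p * Poly_Mapping.lookup g q) (basis_mult p q))" for p
    by (rule sum.mono_neutral_left) (use assms in \<open>auto simp: in_keys_iff\<close>)
  moreover have "(\<Sum>p\<in>Poly_Mapping.keys f. \<Sum>q\<in>T. scale (Poly_Mapping.lookup f p * Poly_Mapping.lookup g q) (basis_mult p q))
     = (\<Sum>p\<in>S. \<Sum>q\<in>T. scale (Poly_Mapping.lookup f p * Poly_Mapping.lookup g q) (basis_mult p q))"
    by (rule sum.mono_neutral_left) (use assms in \<open>auto simp: in_keys_iff\<close>)
  ultimately show ?thesis by (simp add: path_mult_def)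
qed

lemma path_mult_add_left: "path_mult (f + g) h = path_mult f h + path_mult g h"
proof -
  let ?S = "Poly_Mapping.keys f \<union> Poly_Mapping.keys g"
  have S: "finite ?S" "Poly_Mapping.keys (f + g) \<subseteq> ?S" "Poly_Mapping.keys f \<subseteq> ?S" "Poly_Mapping.keys g \<subseteq> ?S"
    using Poly_Mapping.keys_add[of f g] by auto
  show ?thesis
    by (subst (1 2 3) path_mult_superset[where S = ?S and T = "Poly_Mapping.keys h"])
       (use S in \<open>simp_all add: lookup_add distrib_right scale_add sum.distrib\<close>)
qed

lemma path_mult_add_right: "path_mult h (f + g) = path_mult h f + path_mult h g"
proof -
  let ?S = "Poly_Mapping.keys f \<union> Poly_Mapping.keys g"
  have S: "finite ?S" "Poly_Mapping.keys (f + g) \<subseteq> ?S" "Poly_Mapping.keys f \<subseteq> ?S" "Poly_Mapping.keys g \<subseteq> ?S"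
    using Poly_Mapping.keys_add[of f g] by auto
  show ?thesis
    by (subst (1 2 3) path_mult_superset[where T = ?S and S = "Poly_Mapping.keys h"])
       (use S in \<open>simp_all add: lookup_add distrib_left scale_add sum.distrib\<close>)
qed

lemma path_mult_zero [simp]: "path_mult 0 f = 0" "path_mult f 0 = 0"
  by (simp_all add: path_mult_def)

lemma path_mult_scale:
  "path_mult (scale c f) g = scale c (path_mult f g)"
  "path_mult f (scale c g) = scale c (path_mult f g)"
  using keys_scale[of c f] keys_scale[of c g]
  by (subst path_mult_superset[where S = "Poly_Mapping.keys f" and T = "Poly_Mapping.keys g"];
      simp add: path_mult_def scale_sum mult_ac)+

lemma path_mult_single:
  "path_mult (Poly_Mapping.single p a) (Poly_Mapping.single q b) = scale (a * b) (basis_mult p q)"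
  by (subst path_mult_superset[where S = "{p}" and T = "{q}"]) auto

lemma path_comb_induct [case_names zero single add]:
  fixes f :: "'k \<Rightarrow>\<^sub>0 'f::field"
  assumes "P 0" "\<And>k c. k \<in> Poly_Mapping.keys f \<Longrightarrow> P (Poly_Mapping.single k c)"
    "\<And>g h. P g \<Longrightarrow> P h \<Longrightarrow> P (g + h)"
  shows "P f"
proof -
  have "P (\<Sum>k\<in>S. Poly_Mapping.single k (Poly_Mapping.lookup f k))"
    if "finite S" "S \<subseteq> Poly_Mapping.keys f" for S
    using that by (induction S) (auto intro: assms)
  moreover have "f = (\<Sum>k\<in>Poly_Mapping.keys f. Poly_Mapping.single k (Poly_Mapping.lookup f k))"
    by (rule poly_mapping_eqI)
       (simp add: lookup_sum lookup_single when_def in_keys_iff)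
  ultimately show ?thesis by (metis finite_keys order_refl)
qed

lemma path_mult_assoc: "path_mult (path_mult f g) h = path_mult f (path_mult g h)"
proof (induction f rule: path_comb_induct)
  case (single p a)
  show ?case
  proof (induction g rule: path_comb_induct)
    case (single q b)
    show ?case
    proof (induction h rule: path_comb_induct)
      case (single r c)
      show ?case
        by (cases p; cases q; cases r)
           (simp add: path_mult_single path_mult_scale mult_ac)
    qed (simp_all add: path_mult_add_right)
  qed (simp_all add: path_mult_add_left path_mult_add_right)
qed (simp_all add: path_mult_add_left)

lemma keys_basis_mult:
  assumes "wf_digraph Q" "p \<in> qpaths Q" "q \<in> qpaths Q"
  shows "Poly_Mapping.keys (basis_mult p q) \<subseteq> qpaths Q"
proof -
  interpret wf_digraph Q by fact
  show ?thesis using assms(2,3)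
    by (cases p; cases q) (auto simp: qpaths_def)
qed

lemma path_mult_closed:
  assumes "wf_digraph Q" "Poly_Mapping.keys f \<subseteq> qpaths Q" "Poly_Mapping.keys g \<subseteq> qpaths Q"
  shows "Poly_Mapping.keys (path_mult f g) \<subseteq> qpaths Q"
  unfolding path_mult_def
  using assms keys_basis_mult[OF assms(1)]
  by (intro order.trans[OF keys_sum] UN_least order.trans[OF keys_scale]) blast

lemma path_mult_one:
  assumes "fin_digraph Q" "Poly_Mapping.keys f \<subseteq> qpaths Q"
  shows "path_mult (\<Sum>v \<in> verts Q. Poly_Mapping.single (v, [], v) 1) f = f" (is "path_mult ?e f = f")
    and "path_mult f (\<Sum>v \<in> verts Q. Poly_Mapping.single (v, [], v) 1) = f"
proof -
  interpret fin_digraph Q by fact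
  have left: "path_mult (\<Sum>v \<in> S. g v) h = (\<Sum>v \<in> S. path_mult (g v) h)"
    and right: "path_mult h (\<Sum>v \<in> S. g v) = (\<Sum>v \<in> S. path_mult h (g v))"
    if "finite S" for S :: "'a set" and g and h :: "('a, 'b) qpath \<Rightarrow>\<^sub>0 'c"
    using that by (induction S) (simp_all add: path_mult_add_left path_mult_add_right)
  have step: "path_mult ?e (Poly_Mapping.single p c) = Poly_Mapping.single p c \<and>
              path_mult (Poly_Mapping.single p c) ?e = Poly_Mapping.single p c"
    if "p \<in> Poly_Mapping.keys f" for p c
  proof -
    obtain u w v where p: "p = (u, w, v)" by (cases p)
    from that assms(2) have "awalk u w v" by (auto simp: p qpaths_def)
    then have uv: "u \<in> verts Q" "v \<in> verts Q" by auto
    have "scale c (basis_mult (x, [], x) p) = (if x = u then Poly_Mapping.single p c else 0)"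
      "scale c (basis_mult p (x, [], x)) = (if v = x then Poly_Mapping.single p c else 0)" for x
      by (simp_all add: p)
    then show ?thesis using uv
      by (simp add: left right path_mult_single)
  qed
  show "path_mult ?e f = f"
    by (induction f rule: path_comb_induct) (simp_all add: step path_mult_add_right)
  show "path_mult f ?e = f"
    by (induction f rule: path_comb_induct) (simp_all add: step path_mult_add_left)
qed

lemma assoc_algebra_path_algebra:
  assumes "fin_digraph Q"
  shows "assoc_algebra (path_algebra Q :: ('f::field, ('v, 'e) qpath \<Rightarrow>\<^sub>0 'f) module)"
proof -
  interpret fin_digraph Q by fact
  let ?A = "path_algebra Q :: ('f, ('v, 'e) qpath \<Rightarrow>\<^sub>0 'f) module"
  have keys_one: "Poly_Mapping.keys (\<Sum>v \<in> verts Q. Poly_Mapping.single (v, [], v) (1::'f)) \<subseteq> qpaths Q"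
    by (rule order.trans[OF keys_sum]) (auto simp: qpaths_def awalk_Nil_iff)
  have ab: "abelian_group ?A"
  proof (rule abelian_groupI)
    fix x assume "x \<in> carrier ?A"
    then show "\<exists>y\<in>carrier ?A. y \<oplus>\<^bsub>?A\<^esub> x = \<zero>\<^bsub>?A\<^esub>"
      by (intro bexI[of _ "- x"]) (auto simp: path_algebra_def in_keys_iff)
  qed (use Poly_Mapping.keys_add in \<open>force simp: path_algebra_def add_ac\<close>)+
  have mon: "monoid ?A"
    by (rule monoidI)
       (use keys_one path_mult_one[OF assms] in
         \<open>auto simp: path_algebra_def path_mult_assoc
           dest: subsetD[OF path_mult_closed[OF wf_digraph], rotated 2]\<close>)
  have ring: "ring ?A"
    by (rule ringI[OF ab mon])
       (auto simp: path_algebra_def path_mult_add_left path_mult_add_right)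
  have cr: "cring (field_ring :: 'f ring)"
    by (rule cringI, rule abelian_groupI)
       (auto simp: algebra_simps intro: comm_monoidI exI[of _ "- _"])
  have mod: "module field_ring ?A"
    by (rule moduleI[OF cr ab])
       (auto simp: path_algebra_def scale_add dest: subsetD[OF keys_scale])
  show ?thesis
    unfolding assoc_algebra_def assoc_algebra_axioms_def
    using ring mod by (auto simp: path_algebra_def path_mult_scale)
qed

end

theory Submission
  imports Defs "HOL-Combinatorics.Permutations"
begin

text \<open>If two different oriented cycles pass through \<open>v\<close>, they give closed paths \<open>p, q\<close> at \<open>v\<close> with
  different sets of arrows. Commuting words are powers of a common word, so \<open>pq \<noteq> qp\<close>; being
  of equal length, these two paths generate a free algebra of rank 2, which contains free algebras
  of all finite ranks and so satisfies no identity.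

  Conversely, if no vertex lies on two cycles, a path is determined by its end points and its
  multiset of arrows. Hence swapping two factors with the same end points does not change a product
  of paths. Among \<open>n\<^sup>2 + 1\<close> paths, where \<open>n\<close> is the number of vertices, two have the same end
  points, so the terms of the standard polynomial of degree \<open>n\<^sup>2 + 1\<close> cancel in pairs on paths,
  and by multilinearity everywhere.\<close>

section \<open>Combinatorics on words\<close>

text \<open>Codes of one fixed length decode block by block: equal concatenations have equal first
  blocks. Positive length keeps a nonempty word from having an empty code. This serves twice, first
  for bits and then for variables.\<close>

lemma concat_map_uniform_inj:
  assumes "inj_on c A" "\<And>i. i \<in> A \<Longrightarrow> length (c i) = L" "0 < L"
    and "set w \<subseteq> A" "set w' \<subseteq> A" "concat (map c w) = concat (map c w')"
  shows "w = w'"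
  using assms(4-)
proof (induction w arbitrary: w')
  case Nil
  then show ?case using assms(2,3) by (cases w') auto
next
  case (Cons i w)
  then obtain j u where w': "w' = j # u"
    using assms(2,3) by (cases w') auto
  have "length (c i) = length (c j)"
    using Cons.prems w' assms(2) by auto
  then have "c i = c j" "concat (map c w) = concat (map c u)"
    using Cons.prems w' by auto
  then show ?case
    using Cons w' assms(1) by (auto dest: inj_onD)
qed

text \<open>Both words are powers of one common word. Being nonempty, they have positive exponents,
  so each uses exactly the letters of that word.\<close>

lemma commuting_words_same_letters:
  assumes "p @ q = q @ p" "p \<noteq> []" "q \<noteq> []"
  shows "set p = set q"
proof -
  obtain m n zs where "concat (replicate m zs) = p" "concat (replicate n zs) = q"
    using comm_append_are_replicate[OF assms(1)] by blast
  then show ?thesis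
    using assms(2,3) by (cases m; cases n) auto
qed

section \<open>Closed paths and the cycle condition\<close>

context wf_digraph
begin

text \<open>A closed path with support \<open>C\<close> may start anywhere on \<open>C\<close>.
  Cutting it at a visit to \<open>v\<close> and exchanging the two pieces makes it start at
  \<open>v\<close>; the support depends only on the set of arrows.\<close>

lemma oriented_cycle_closed_walk:
  assumes "oriented_cycle G C" "v \<in> verts C"
  obtains p where "awalk v p v" "p \<noteq> []" "C = path_support G p"
proof -
  obtain u p where p: "awalk u p u" "p \<noteq> []" "C = path_support G p"
    using assms(1) by (auto simp: oriented_cycle_def)
  from assms(2) obtain e where e: "e \<in> set p" "v = tail G e \<or> v = head G e"
    by (auto simp: p path_support_def)
  then obtain p1 p2 where split: "p = p1 @ e # p2"
    by (meson split_list)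
  with p(1) have walks: "awalk u p1 (tail G e)" "awalk (tail G e) [e] (head G e)"
    "awalk (head G e) p2 u"
    by (auto simp: awalk_Cons_iff awalk_Nil_iff)
  obtain q1 q2 where q: "p = q1 @ q2" "awalk u q1 v" "awalk v q2 u"
  proof (cases "v = tail G e")
    case True
    then show thesis
      using that[of p1 "e # p2"] walks split awalk_appendI[OF walks(2,3)] by simp
  next
    case False
    then show thesis
      using that[of "p1 @ [e]" p2] walks split e(2) awalk_appendI[OF walks(1,2)] by simp
  qed
  have "awalk v (q2 @ q1) v"
    using q by auto
  moreover have "path_support G (q2 @ q1) = C"
    using p(3) q(1) by (simp add: path_support_def Un_commute)
  ultimately show thesis
    using that[of "q2 @ q1"] p(2) q(1) by auto
qed

text \<open>If the first arrows \<open>a\<close> and \<open>b\<close> differ, each path must return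
  to \<open>u\<close> before using the first arrow of the other. Both return loops pass through
  \<open>u\<close>, so uniqueness gives them the same arrows, although one of them avoids
  \<open>a\<close>.\<close>

lemma awalk_determined_by_mset:
  assumes unique: "\<And>v. v \<in> verts G \<Longrightarrow> \<exists>\<^sub>\<le>\<^sub>1 C. oriented_cycle G C \<and> v \<in> verts C"
    and "awalk u p v" "awalk u q v" "mset p = mset q"
  shows "p = q"
  using assms(2-)
proof (induction p arbitrary: u q)
  case Nil
  then show ?case by simp
next
  case (Cons a p)
  then obtain b r where q: "q = b # r"
    by (cases q) auto
  show ?case
  proof (cases "a = b")
    case True
    then show ?thesis
      using Cons q by (auto simp: awalk_Cons_iff)
  next
    case False
    have u: "u \<in> verts G" "tail G a = u" "tail G b = u"
      using Cons.prems q by (auto simp: awalk_Cons_iff)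
    have "b \<in> set (a # p)" "a \<in> set (b # r)"
      using Cons.prems(3) q by (metis list.set_intros(1) set_mset_mset)+
    with False have "b \<in> set p" "a \<in> set r" by auto
    \<comment> \<open>The first occurrence of \<open>a\<close> is taken in \<open>r\<close>, so that
      the loop \<open>b # r1\<close> misses \<open>a\<close>. Any occurrence of \<open>b\<close> in
      \<open>p\<close> will do.\<close>
    then obtain p1 p2 r1 r2 where split: "p = p1 @ b # p2" "r = r1 @ a # r2" "a \<notin> set r1"
      by (metis split_list split_list_first)
    have "awalk u (a # p1) u"
      using Cons.prems(1) split u by (auto simp: awalk_Cons_iff awalk_append_iff)
    moreover have "awalk u (b # r1) u"
      using Cons.prems(2) q split u by (auto simp: awalk_Cons_iff awalk_append_iff)
    ultimately have "oriented_cycle G (path_support G (a # p1))"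
      "oriented_cycle G (path_support G (b # r1))"
      unfolding oriented_cycle_def by blast+
    moreover have "u \<in> verts (path_support G (a # p1))" "u \<in> verts (path_support G (b # r1))"
      using u by (auto simp: path_support_def)
    ultimately have "path_support G (a # p1) = path_support G (b # r1)"
      using unique[OF u(1)] by (auto simp: Uniq_def)
    then have "set (a # p1) = set (b # r1)"
      by (simp add: path_support_def)
    with False split(3) show ?thesis by auto
  qed
qed

end

section \<open>Products of paths and monomials in the path algebra\<close>

text \<open>Only end points are read and arrows are tracked separately, so exchanging factors with
  equal ends cannot affect composability. The empty case does not check that \<open>u\<close> is a
  vertex, hence the assumption on \<open>u\<close> in the lemmas that use it.\<close>

fun composable :: "'v \<Rightarrow> ('v, 'e) qpath list \<Rightarrow> 'v \<Rightarrow> bool" where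
  "composable u [] v \<longleftrightarrow> u = v"
| "composable u ((a, p, b) # ks) v \<longleftrightarrow> a = u \<and> composable b ks v"

lemma composable_same_ends:
  assumes "\<And>i. i \<in> set w \<Longrightarrow> fst (k i) = fst (l i) \<and> snd (snd (k i)) = snd (snd (l i))"
  shows "composable u (map k w) v \<longleftrightarrow> composable u (map l w) v"
  using assms
proof (induction w arbitrary: u)
  case (Cons i w)
  then show ?case
    using Cons.prems[of i] by (cases "k i"; cases "l i") auto
qed simp

lemma (in wf_digraph) awalk_composable:
  assumes "set ks \<subseteq> qpaths G" "u \<in> verts G" "composable u ks v"
  shows "awalk u (concat (map (fst \<circ> snd) ks)) v"
  using assms
proof (induction ks arbitrary: u)
  case Nil
  then show ?case by (simp add: awalk_Nil_iff)
next
  case (Cons k ks)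
  obtain a p b where k: "k = (a, p, b)" by (cases k)
  with Cons.prems have "awalk u p b" by (auto simp: qpaths_def)
  moreover from this have "b \<in> verts G" by auto
  ultimately show ?case
    using Cons k by auto
qed

lemma path_algebra_simps [simp]:
  "x \<in> carrier (path_algebra Q) \<longleftrightarrow> Poly_Mapping.keys x \<subseteq> qpaths Q"
  "x \<otimes>\<^bsub>path_algebra Q\<^esub> y = path_mult x y"
  "\<one>\<^bsub>path_algebra Q\<^esub> = (\<Sum>v \<in> verts Q. Poly_Mapping.single (v, [], v) 1)"
  "\<zero>\<^bsub>path_algebra Q\<^esub> = 0"
  "x \<oplus>\<^bsub>path_algebra Q\<^esub> y = x + y"
  "c \<odot>\<^bsub>path_algebra Q\<^esub> x = scale c x"
  by (simp_all add: path_algebra_def)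

text \<open>This is the value of one word inside \<open>nc_eval\<close>, without its coefficient and
  with the operations of the path algebra written out.\<close>

definition monomial_value ::
  "('v, 'e) pre_digraph \<Rightarrow> (nat \<Rightarrow> ('v, 'e) qpath \<Rightarrow>\<^sub>0 'f::field) \<Rightarrow> nat list \<Rightarrow> ('v, 'e) qpath \<Rightarrow>\<^sub>0 'f"
where
  "monomial_value Q a w =
     foldr (\<lambda>i. path_mult (a i)) w (\<Sum>v \<in> verts Q. Poly_Mapping.single (v, [], v) 1)"

lemma monomial_value_Cons [simp]:
  "monomial_value Q a (i # w) = path_mult (a i) (monomial_value Q a w)"
  by (simp add: monomial_value_def)

lemma lookup_monomial_value_Nil:
  assumes "finite (verts Q)" "u \<in> verts Q"
  shows "Poly_Mapping.lookup (monomial_value Q a []) (u, p, v) = (if p = [] \<and> u = v then 1 else 0)"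
proof -
  have "Poly_Mapping.lookup (monomial_value Q a []) (u, p, v) =
      (\<Sum>x \<in> verts Q. if x = u then (if p = [] \<and> u = v then 1 else 0) else 0)"
    unfolding monomial_value_def foldr.simps id_apply lookup_sum
    by (intro sum.cong) (auto simp: lookup_single when_def)
  then show ?thesis using assms by simp
qed

lemma monomial_value_closed:
  assumes "wf_digraph Q" "\<And>i. i \<in> set w \<Longrightarrow> Poly_Mapping.keys (a i) \<subseteq> qpaths Q"
  shows "Poly_Mapping.keys (monomial_value Q a w) \<subseteq> qpaths Q"
  using assms(2)
proof (induction w)
  case Nil
  interpret wf_digraph Q by fact
  show ?case unfolding monomial_value_def foldr.simps id_apply
    by (rule order.trans[OF keys_sum]) (auto simp: qpaths_def awalk_Nil_iff)
next
  case (Cons i w)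
  then show ?case by (simp add: path_mult_closed[OF assms(1)])
qed

lemma monomial_value_cong:
  assumes "\<And>i. i \<in> set w \<Longrightarrow> a i = b i"
  shows "monomial_value Q a w = monomial_value Q b w"
  unfolding monomial_value_def using assms by (auto intro: foldr_cong)

lemma monomial_value_add:
  assumes "distinct w" "j \<in> set w"
  shows "monomial_value Q (a(j := g + h)) w =
    monomial_value Q (a(j := g)) w + monomial_value Q (a(j := h)) w"
  using assms
proof (induction w)
  case (Cons i w)
  show ?case
  proof (cases "i = j")
    case True
    \<comment> \<open>By distinctness the rest of the word is free of \<open>j\<close>; a single
      occurrence is what makes the value additive in that argument.\<close>
    then have "monomial_value Q (a(j := x)) w = monomial_value Q a w" for x
      using Cons.prems by (auto intro: monomial_value_cong)
    then show ?thesis using True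
      by (simp add: path_mult_add_left fun_upd_same del: fun_upd_apply)
  next
    case False
    then show ?thesis using Cons by (simp add: path_mult_add_right)
  qed
qed simp

lemma monomial_value_zero:
  assumes "j \<in> set w" "a j = 0"
  shows "monomial_value Q a w = 0"
  using assms by (induction w) auto

text \<open>The coefficient at \<open>p\<close> can come only from a factorization
  \<open>p = r @ s\<close>. It exists exactly when \<open>r\<close> is a prefix of \<open>p\<close>,
  and then \<open>s\<close> is determined.\<close>

lemma lookup_path_mult_single:
  "Poly_Mapping.lookup (path_mult (Poly_Mapping.single (a, r, b) c) g) (u, p, v) =
    (if u = a \<and> take (length r) p = r then c * Poly_Mapping.lookup g (b, drop (length r) p, v) else 0)"
proof (induction g rule: path_comb_induct)
  case (single k d)
  obtain x s y where k: "k = (x, s, y)" by (cases k)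
  have "r @ s = p \<longleftrightarrow> take (length r) p = r \<and> s = drop (length r) p"
    by (metis append_eq_conv_conj)
  then show ?case
    by (auto simp: k path_mult_single lookup_single when_def)
qed (auto simp: path_mult_add_right lookup_add distrib_left)

text \<open>A product of scalar multiples of paths is zero or a scalar multiple of one path. For the
  empty word, \<open>u\<close> must be a vertex because the unit contains lazy paths at vertices
  only.\<close>

lemma lookup_monomial_value_single:
  assumes "fin_digraph Q" "u \<in> verts Q" "\<And>i. i \<in> set w \<Longrightarrow> k i \<in> qpaths Q"
  shows "Poly_Mapping.lookup (monomial_value Q (\<lambda>i. Poly_Mapping.single (k i) (c i)) w) (u, p, v) =
    (if composable u (map k w) v \<and> p = concat (map (fst \<circ> snd) (map k w))
     then prod_list (map c w) else 0)"
  using assms(2,3)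
proof (induction w arbitrary: u p)
  case Nil
  interpret fin_digraph Q by fact
  show ?case by (auto simp: lookup_monomial_value_Nil[OF finite_verts Nil(1)])
next
  case (Cons i w)
  interpret fin_digraph Q by fact
  obtain a r b where k: "k i = (a, r, b)" by (cases "k i")
  then have "awalk a r b" using Cons.prems(2)[of i] by (auto simp: qpaths_def)
  then have b: "b \<in> verts Q" by auto
  have "p = r @ s \<longleftrightarrow> take (length r) p = r \<and> drop (length r) p = s" for s
    by (metis append_eq_conv_conj)
  then show ?case
    using Cons.IH[OF b] Cons.prems(2)
    by (auto simp: k lookup_path_mult_single)
qed

lemma finsum_path_algebra:
  assumes "fin_digraph Q" "\<And>x. x \<in> S \<Longrightarrow> Poly_Mapping.keys (g x) \<subseteq> qpaths Q"
  shows "finsum (path_algebra Q) g S = sum g S"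
proof -
  interpret assoc_algebra "path_algebra Q"
    by (rule assoc_algebra_path_algebra) fact
  show ?thesis
  proof (cases "finite S")
    case True
    then show ?thesis using assms(2)
      by (induction S) (auto simp: finsum_insert)
  qed (simp add: finsum_infinite)
qed

text \<open>The sum may run over any finite \<open>S\<close> containing the support, so evaluation
  does not require knowing the support exactly.\<close>

lemma nc_eval_path_algebra:
  assumes "fin_digraph Q" "\<And>i. i < N \<Longrightarrow> Poly_Mapping.keys (a i) \<subseteq> qpaths Q"
    and "f \<in> nc_polynomials N" "finite S" "Poly_Mapping.keys f \<subseteq> S"
  shows "nc_eval (path_algebra Q) f a = (\<Sum>w\<in>S. scale (Poly_Mapping.lookup f w) (monomial_value Q a w))"
proof -
  interpret fin_digraph Q by fact
  have "Poly_Mapping.keys (monomial_value Q a w) \<subseteq> qpaths Q" if "w \<in> Poly_Mapping.keys f" for w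
    using assms(2,3) that
    by (intro monomial_value_closed[OF wf_digraph]) (auto simp: nc_polynomials_def)
  then have "nc_eval (path_algebra Q) f a =
      (\<Sum>w\<in>Poly_Mapping.keys f. scale (Poly_Mapping.lookup f w) (monomial_value Q a w))"
    unfolding nc_eval_def path_algebra_simps monomial_value_def[symmetric]
    by (intro finsum_path_algebra[OF assms(1)] order.trans[OF keys_scale])
  also have "\<dots> = (\<Sum>w\<in>S. scale (Poly_Mapping.lookup f w) (monomial_value Q a w))"
    by (rule sum.mono_neutral_left) (use assms in \<open>auto simp: in_keys_iff\<close>)
  finally show ?thesis .
qed

section \<open>Noncommuting closed paths exclude every identity\<close>

lemma not_PI_path_algebra:
  fixes Q :: "('v, 'e) pre_digraph"
  assumes "fin_digraph Q" "pre_digraph.awalk Q v p v" "pre_digraph.awalk Q v q v"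
    and "p @ q \<noteq> q @ p"
  shows "\<not> PI_algebra (path_algebra Q :: ('f::field, ('v, 'e) qpath \<Rightarrow>\<^sub>0 'f) module)"
proof
  interpret fin_digraph Q by fact
  assume "PI_algebra (path_algebra Q :: ('f, ('v, 'e) qpath \<Rightarrow>\<^sub>0 'f) module)"
  then obtain N and f :: "nat list \<Rightarrow>\<^sub>0 'f" where f: "f \<in> nc_polynomials N" "f \<noteq> 0"
    and identity: "\<And>a. (\<And>i. i < N \<Longrightarrow> a i \<in> carrier (path_algebra Q)) \<Longrightarrow>
      nc_eval (path_algebra Q) f a = \<zero>\<^bsub>path_algebra Q\<^esub>"
    unfolding PI_algebra_def by blast
  obtain w where w: "w \<in> Poly_Mapping.keys f"
    using f(2) by (meson keys_eq_empty ex_in_conv)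
  \<comment> \<open>The two orders of composition code one bit by distinct closed paths of equal
    length.\<close>
  define x where "x b = (if b then p @ q else q @ p)" for b
  have x: "inj_on x UNIV" "length (x b) = length p + length q" for b
    using assms(4) by (auto simp: x_def inj_on_def)
  \<comment> \<open>Variable \<open>i\<close> is coded by the indicator vector of \<open>i\<close>
    among \<open>N\<close> bits. This gives distinct closed paths of one common length, whatever
    \<open>N\<close> is.\<close>
  define c where "c i = concat (map x (map (\<lambda>j. j = i) [0..<N]))" for i
  have pos: "0 < length p + length q"
    using assms(4) by auto
  have c_inj: "inj_on c {..<N}"
  proof (rule inj_onI)
    fix i j assume ij: "i \<in> {..<N}" "j \<in> {..<N}" "c i = c j"
    then have "map (\<lambda>l. l = i) [0..<N] = map (\<lambda>l. l = j) [0..<N]"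
      using concat_map_uniform_inj[OF x(1) x(2) pos] unfolding c_def by blast
    with ij(1) show "i = j" by auto
  qed
  have c_length: "length (c i) = N * (length p + length q)" for i
    unfolding c_def by (simp add: length_concat o_def x sum_list_triv)
  have c_decode: "w' = w" if "set w \<subseteq> {..<N}" "set w' \<subseteq> {..<N}"
    "concat (map c w) = concat (map c w')" for w w'
  proof (cases "N = 0")
    \<comment> \<open>Here the codes have length 0 and cannot be decoded, but both words are
      empty.\<close>
    case True
    with that show ?thesis by simp
  next
    case False
    with that show ?thesis
      using concat_map_uniform_inj[OF c_inj c_length] pos by (metis mult_pos_pos neq0_conv)
  qed
  have x_walk: "awalk v (concat (map x bs)) v" for bs
  proof (induction bs)
    case Nil
    then show ?case using assms(2) by (auto simp: awalk_Nil_iff)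
  next
    case (Cons b bs)
    then show ?case using assms(2,3) by (auto simp: x_def)
  qed
  then have c_walk: "(v, c i, v) \<in> qpaths Q" for i
    by (simp add: qpaths_def c_def del: map_map)
  define a where "a i = Poly_Mapping.single (v, c i, v) (1::'f)" for i
  have composable: "composable v (map (\<lambda>i. (v, c i, v)) u) v" for u
    by (induction u) auto
  have v: "v \<in> verts Q" using assms(2) by auto
  have one: "prod_list (map (\<lambda>_. 1 :: 'f) u) = 1" for u :: "nat list"
    by (induction u) auto
  have lookup: "Poly_Mapping.lookup (monomial_value Q a u) (v, r, v) =
      (if r = concat (map c u) then 1 else 0)" for u r
    using lookup_monomial_value_single[OF assms(1) v, of u "\<lambda>i. (v, c i, v)" "\<lambda>_. 1 :: 'f"] c_walk composable
    by (simp add: a_def[abs_def] o_def one)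
  have letters: "set u \<subseteq> {..<N}" if "u \<in> Poly_Mapping.keys f" for u
    using f(1) that by (auto simp: nc_polynomials_def)
  have a: "Poly_Mapping.keys (a i) \<subseteq> qpaths Q" for i
    using c_walk by (simp add: a_def)
  \<comment> \<open>The coefficient is read at the path coding \<open>w\<close>. By unique decoding
    no other word of \<open>f\<close> contributes there, so the identity would make a nonzero
    coefficient of \<open>f\<close> vanish.\<close>
  have "0 = Poly_Mapping.lookup (nc_eval (path_algebra Q) f a) (v, concat (map c w), v)"
    using identity[of a] a by simp
  also have "\<dots> = (\<Sum>u\<in>Poly_Mapping.keys f. Poly_Mapping.lookup f u *
      (if concat (map c w) = concat (map c u) then 1 else 0))"
    by (subst nc_eval_path_algebra[OF assms(1) a f(1) finite_keys order_refl])
       (simp add: lookup_sum lookup)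
  also have "\<dots> = (\<Sum>u\<in>Poly_Mapping.keys f. if u = w then Poly_Mapping.lookup f u else 0)"
    using c_decode letters w by (intro sum.cong) auto
  also have "\<dots> = Poly_Mapping.lookup f w"
    using w by simp
  finally show False
    using w by (simp add: in_keys_iff)
qed

section \<open>The standard polynomial\<close>

definition standard_polynomial :: "nat \<Rightarrow> nat list \<Rightarrow>\<^sub>0 'f::field" where
  "standard_polynomial N =
     (\<Sum>\<sigma> | \<sigma> permutes {..<N}. Poly_Mapping.single (map \<sigma> [0..<N]) (of_int (sign \<sigma>)))"

lemma inj_on_permutation_word: "inj_on (\<lambda>\<sigma>. map \<sigma> [0..<N]) {\<sigma>. \<sigma> permutes {..<N}}"
proof (rule inj_onI)
  fix \<sigma> \<tau> assume "\<sigma> \<in> {\<sigma>. \<sigma> permutes {..<N}}" "\<tau> \<in> {\<sigma>. \<sigma> permutes {..<N}}"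
    and eq: "map \<sigma> [0..<N] = map \<tau> [0..<N]"
  then have "\<sigma> i = \<tau> i" for i
    by (cases "i < N") (auto simp: permutes_not_in)
  then show "\<sigma> = \<tau>" by blast
qed

text \<open>Distinct permutations give distinct words, so no two terms merge. The identity
  permutation then has coefficient 1, which makes the polynomial nonzero in every
  characteristic.\<close>

lemma lookup_standard_polynomial:
  assumes "\<sigma> permutes {..<N}"
  shows "Poly_Mapping.lookup (standard_polynomial N) (map \<sigma> [0..<N]) = (of_int (sign \<sigma>) :: 'f::field)"
proof -
  have "Poly_Mapping.lookup (standard_polynomial N) (map \<sigma> [0..<N]) =
      (\<Sum>\<tau> | \<tau> permutes {..<N}. if \<tau> = \<sigma> then (of_int (sign \<sigma>) :: 'f) else 0)"
    unfolding standard_polynomial_def lookup_sum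
    using inj_on_permutation_word[of N] assms
    by (intro sum.cong) (auto simp: lookup_single when_def inj_on_def simp del: map_eq_conv)
  then show ?thesis
    using assms by (simp add: finite_permutations)
qed

lemma keys_standard_polynomial:
  "Poly_Mapping.keys (standard_polynomial N) \<subseteq> (\<lambda>\<sigma>. map \<sigma> [0..<N]) ` {\<sigma>. \<sigma> permutes {..<N}}"
  unfolding standard_polynomial_def
  by (rule order.trans[OF keys_sum]) auto

lemma standard_polynomial_in_nc_polynomials: "standard_polynomial N \<in> nc_polynomials N"
  using keys_standard_polynomial[of N]
  by (fastforce simp: nc_polynomials_def dest: permutes_in_image)

lemma standard_polynomial_nonzero: "standard_polynomial N \<noteq> 0"
  using lookup_standard_polynomial[OF permutes_id, of N]
  by (metis lookup_zero of_int_1 sign_id zero_neq_one)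

lemma nc_eval_standard_polynomial:
  assumes "fin_digraph Q" "\<And>i. i < N \<Longrightarrow> Poly_Mapping.keys (a i) \<subseteq> qpaths Q"
  shows "nc_eval (path_algebra Q) (standard_polynomial N) a =
    (\<Sum>\<sigma> | \<sigma> permutes {..<N}. scale (of_int (sign \<sigma>)) (monomial_value Q a (map \<sigma> [0..<N])))"
proof -
  let ?P = "{\<sigma>. \<sigma> permutes {..<N}}"
  have "finite ((\<lambda>\<sigma>. map \<sigma> [0..<N]) ` ?P)"
    by (intro finite_imageI finite_permutations) simp
  then have "nc_eval (path_algebra Q) (standard_polynomial N) a =
      (\<Sum>w\<in>(\<lambda>\<sigma>. map \<sigma> [0..<N]) ` ?P.
        scale (Poly_Mapping.lookup (standard_polynomial N) w) (monomial_value Q a w))"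
    using assms
    by (intro nc_eval_path_algebra[where N = N] standard_polynomial_in_nc_polynomials keys_standard_polynomial)
  also have "\<dots> = (\<Sum>\<sigma>\<in>?P. scale (of_int (sign \<sigma>)) (monomial_value Q a (map \<sigma> [0..<N])))"
    unfolding sum.reindex[OF inj_on_permutation_word] o_def
    by (rule sum.cong) (simp_all add: lookup_standard_polynomial)
  finally show ?thesis .
qed

text \<open>The permutations are split into even and odd ones, since \<open>S = - S\<close> would not give \<open>S = 0\<close>
  in characteristic 2.\<close>

lemma alternating_sum_eq_0:
  fixes g :: "(nat \<Rightarrow> nat) \<Rightarrow> 'k \<Rightarrow>\<^sub>0 'f::field"
  assumes ij: "i < N" "j < N" "i \<noteq> j"
    and sym: "\<And>\<sigma>. \<sigma> permutes {..<N} \<Longrightarrow> g (transpose i j \<circ> \<sigma>) = g \<sigma>"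
  shows "(\<Sum>\<sigma> | \<sigma> permutes {..<N}. scale (of_int (sign \<sigma>)) (g \<sigma>)) = 0"
proof -
  let ?t = "\<lambda>\<sigma>. transpose i j \<circ> \<sigma>"
  let ?E = "{\<sigma>. \<sigma> permutes {..<N} \<and> evenperm \<sigma>}"
  let ?O = "{\<sigma>. \<sigma> permutes {..<N} \<and> \<not> evenperm \<sigma>}"
  have t: "?t \<sigma> permutes {..<N}" "evenperm (?t \<sigma>) \<longleftrightarrow> \<not> evenperm \<sigma>"
    if "\<sigma> permutes {..<N}" for \<sigma>
  proof -
    show "?t \<sigma> permutes {..<N}"
      using ij that by (intro permutes_compose permutes_swap_id) auto
    have "permutation \<sigma>"
      using that permutation_permutes by blast
    then show "evenperm (?t \<sigma>) \<longleftrightarrow> \<not> evenperm \<sigma>"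
      using ij(3) by (simp add: evenperm_comp permutation_swap_id evenperm_swap)
  qed
  have invol: "?t (?t \<sigma>) = \<sigma>" for \<sigma> :: "nat \<Rightarrow> nat"
    by (auto simp: fun_eq_iff)
  have fin: "finite ?E" "finite ?O"
    by (auto intro: finite_subset[OF _ finite_permutations[of "{..<N}"]])
  \<comment> \<open>Composition with the transposition is an involution exchanging even and odd
    permutations. It preserves \<open>g\<close> and turns the odd part into minus the even
    part.\<close>
  have odd: "(\<Sum>\<sigma>\<in>?O. scale (of_int (sign \<sigma>)) (g \<sigma>)) = (\<Sum>\<sigma>\<in>?E. - g \<sigma>)"
  proof (rule sum.reindex_bij_witness[of _ ?t ?t])
    fix \<sigma> assume "\<sigma> \<in> ?O"
    then have "g (?t \<sigma>) = g \<sigma>" "sign \<sigma> = -1" using sym by (auto simp: sign_def)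
    moreover have "scale (-1) (g \<sigma>) = - g \<sigma>"
      by (rule poly_mapping_eqI) simp
    ultimately show "- g (?t \<sigma>) = scale (of_int (sign \<sigma>)) (g \<sigma>)" by simp
  qed (use t invol in \<open>auto simp del: comp_apply\<close>)
  have "(\<Sum>\<sigma> | \<sigma> permutes {..<N}. scale (of_int (sign \<sigma>)) (g \<sigma>)) =
      (\<Sum>\<sigma>\<in>?E \<union> ?O. scale (of_int (sign \<sigma>)) (g \<sigma>))"
    by (rule sum.cong) auto
  also have "\<dots> = (\<Sum>\<sigma>\<in>?E. scale (of_int (sign \<sigma>)) (g \<sigma>)) + (\<Sum>\<sigma>\<in>?O. scale (of_int (sign \<sigma>)) (g \<sigma>))"
    by (rule sum.union_disjoint[OF fin]) auto
  also have "(\<Sum>\<sigma>\<in>?E. scale (of_int (sign \<sigma>)) (g \<sigma>)) = (\<Sum>\<sigma>\<in>?E. g \<sigma>)"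
    by (rule sum.cong) (auto simp: sign_def)
  finally show ?thesis
    by (simp add: odd sum_negf)
qed

section \<open>The standard identity under the cycle condition\<close>

text \<open>The factors \<open>k i\<close> and \<open>k j\<close> trade places. Composability
  depends only on their common ends, while the multiset of arrows and the product of scalars are
  unchanged; the cycle condition then forces the two product paths to agree.\<close>

lemma monomial_value_transpose:
  fixes c :: "nat \<Rightarrow> 'f::field"
  assumes "fin_digraph Q"
    and unique: "\<forall>v \<in> verts Q. \<exists>\<^sub>\<le>\<^sub>1 C. oriented_cycle Q C \<and> v \<in> verts C"
    and paths: "\<And>i. i < N \<Longrightarrow> k i \<in> qpaths Q"
    and ij: "i < N" "j < N" "fst (k i) = fst (k j)" "snd (snd (k i)) = snd (snd (k j))"
    and \<sigma>: "\<sigma> permutes {..<N}"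
  defines "a \<equiv> \<lambda>i. Poly_Mapping.single (k i) (c i)"
  shows "monomial_value Q a (map (transpose i j \<circ> \<sigma>) [0..<N]) = monomial_value Q a (map \<sigma> [0..<N])"
proof -
  interpret fin_digraph Q by fact
  let ?w = "map \<sigma> [0..<N]" and ?w' = "map (transpose i j \<circ> \<sigma>) [0..<N]"
  let ?arcs = "\<lambda>w. concat (map (fst \<circ> snd) (map k w))"
  have "transpose i j permutes {..<N}"
    using ij by (intro permutes_swap_id) auto
  then have \<tau>: "transpose i j \<circ> \<sigma> permutes {..<N}"
    using \<sigma> by (rule permutes_compose[rotated])
  have mset_word: "mset (map \<rho> [0..<N]) = mset_set {..<N}" if "\<rho> permutes {..<N}" for \<rho> :: "nat \<Rightarrow> nat"
    using that by (simp add: atLeast0LessThan image_mset_mset_set permutes_inj_on permutes_image)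
  have mset: "mset ?w = mset ?w'"
    using mset_word[OF \<sigma>] mset_word[OF \<tau>] by simp
  have set_w: "set ?w = {..<N}" "set ?w' = {..<N}"
    using permutes_image[OF \<sigma>] permutes_image[OF \<tau>] by (simp_all add: atLeast0LessThan)
  have w: "k l \<in> qpaths Q" if "l \<in> set ?w \<or> l \<in> set ?w'" for l
    using that paths unfolding set_w by auto
  have composable: "composable u (map k ?w') v \<longleftrightarrow> composable u (map k ?w) v" for u v
    using composable_same_ends[of "[0..<N]" "k \<circ> (transpose i j \<circ> \<sigma>)" "k \<circ> \<sigma>" u v] ij(3,4)
    by (auto simp: transpose_def)
  have "mset (?arcs u) = (\<Sum>l\<in>#mset u. mset (fst (snd (k l))))" for u
    by (induction u) auto
  with mset have "mset (?arcs ?w) = mset (?arcs ?w')"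
    by metis
  then have arcs: "?arcs ?w' = ?arcs ?w" if "u \<in> verts Q" "composable u (map k ?w) v" for u v
  proof -
    have "awalk u (?arcs ?w') v" "awalk u (?arcs ?w) v"
      by (rule awalk_composable; use that w composable in \<open>auto simp del: map_map\<close>)+
    then show ?thesis
      using \<open>mset (?arcs ?w) = mset (?arcs ?w')\<close>
      by (intro awalk_determined_by_mset[OF unique[rule_format]]) (simp_all del: map_map)
  qed
  have prod: "prod_list (map c ?w') = prod_list (map c ?w)"
    using mset by (metis mset_map prod_mset_prod_list)
  have "Poly_Mapping.lookup (monomial_value Q a ?w') (u, p, v) =
      Poly_Mapping.lookup (monomial_value Q a ?w) (u, p, v)" for u p v
  proof (cases "u \<in> verts Q")
    case True
    \<comment> \<open>The arrow lists are known to agree only when the factors compose; otherwise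
      both coefficients vanish.\<close>
    have "composable u (map k ?w) v \<and> p = ?arcs ?w' \<longleftrightarrow> composable u (map k ?w) v \<and> p = ?arcs ?w"
      by (rule conj_cong[OF refl]) (simp only: arcs[OF True])
    moreover have "Poly_Mapping.lookup (monomial_value Q a z) (u, p, v) =
      (if composable u (map k z) v \<and> p = ?arcs z then prod_list (map c z) else 0)"
      if "z = ?w \<or> z = ?w'" for z
      unfolding a_def by (rule lookup_monomial_value_single[OF assms(1) True], rule w) (metis that)
    ultimately show ?thesis
      by (simp only: composable prod simp_thms)
  next
    \<comment> \<open>Monomial values are supported on paths of \<open>Q\<close>, so no coefficient
      occurs at a triple that starts outside the vertex set.\<close>
    case False
    then have "(u, p, v) \<notin> qpaths Q"
      by (auto simp: qpaths_def)
    moreover have "Poly_Mapping.keys (monomial_value Q a z) \<subseteq> qpaths Q" if "z = ?w \<or> z = ?w'" for z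
    proof (rule monomial_value_closed[OF wf_digraph])
      fix l assume "l \<in> set z"
      with that w[of l] have "k l \<in> qpaths Q" by metis
      then show "Poly_Mapping.keys (a l) \<subseteq> qpaths Q" by (simp add: a_def)
    qed
    ultimately show ?thesis
      by (metis in_keys_iff subsetD)
  qed
  then show ?thesis
    by (auto intro: poly_mapping_eqI)
qed

text \<open>The scalars \<open>c\<close> are carried along because the multilinear expansion below
  produces scalar multiples of paths.\<close>

lemma standard_identity_on_paths:
  assumes "fin_digraph Q"
    and "\<forall>v \<in> verts Q. \<exists>\<^sub>\<le>\<^sub>1 C. oriented_cycle Q C \<and> v \<in> verts C"
    and N: "(card (verts Q))\<^sup>2 < N"
    and paths: "\<And>i. i < N \<Longrightarrow> k i \<in> qpaths Q"
  shows "(\<Sum>\<sigma> | \<sigma> permutes {..<N}. scale (of_int (sign \<sigma>))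
    (monomial_value Q (\<lambda>i. Poly_Mapping.single (k i) (c i)) (map \<sigma> [0..<N]))) = 0"
proof -
  interpret fin_digraph Q by fact
  let ?ends = "\<lambda>i. (fst (k i), snd (snd (k i)))"
  have "?ends ` {..<N} \<subseteq> verts Q \<times> verts Q"
    using paths by (fastforce simp: qpaths_def)
  then have "card (?ends ` {..<N}) \<le> (card (verts Q))\<^sup>2"
    by (metis card_cartesian_product card_mono finite_SigmaI finite_verts power2_eq_square)
  then have "\<not> inj_on ?ends {..<N}"
    using N by (intro pigeonhole) simp
  then obtain i j where "i < N" "j < N" "i \<noteq> j" "?ends i = ?ends j"
    by (auto simp: inj_on_def)
  then show ?thesis
    using paths
    by (intro alternating_sum_eq_0[of i N j] monomial_value_transpose[OF assms(1,2)]) auto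
qed

lemma standard_identity:
  fixes a :: "nat \<Rightarrow> ('v, 'e) qpath \<Rightarrow>\<^sub>0 'f::field"
  assumes "fin_digraph Q"
    and "\<forall>v \<in> verts Q. \<exists>\<^sub>\<le>\<^sub>1 C. oriented_cycle Q C \<and> v \<in> verts C"
    and "(card (verts Q))\<^sup>2 < N"
    and "\<And>i. i < N \<Longrightarrow> Poly_Mapping.keys (a i) \<subseteq> qpaths Q"
  shows "(\<Sum>\<sigma> | \<sigma> permutes {..<N}. scale (of_int (sign \<sigma>)) (monomial_value Q a (map \<sigma> [0..<N]))) = 0"
proof -
  let ?S = "\<lambda>a. \<Sum>\<sigma> | \<sigma> permutes {..<N}. scale (of_int (sign \<sigma>)) (monomial_value Q a (map \<sigma> [0..<N]))"
  have distinct: "distinct (map \<sigma> [0..<N])" and letters: "set (map \<sigma> [0..<N]) = {..<N}"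
    if "\<sigma> permutes {..<N}" for \<sigma>
    using permutes_image[OF that] permutes_inj_on[OF that]
    by (simp_all add: distinct_map atLeast0LessThan)
  \<comment> \<open>Paths and scalars will be chosen only for indices below \<open>N\<close>, so the
    sum must be insensitive to all other arguments.\<close>
  have cong: "?S a = ?S b" if "\<And>i. i < N \<Longrightarrow> a i = b i" for a b
    using that letters by (intro sum.cong refl arg_cong[where f = "scale _"] monomial_value_cong) auto
  \<comment> \<open>Arguments below \<open>m\<close> are arbitrary and those from \<open>m\<close>
    to \<open>N - 1\<close> are scalar multiples of paths. Thus \<open>m = 0\<close> is the case of
    paths and \<open>m = N\<close> the full claim. Quantifying over \<open>a\<close> allows the
    induction step to replace argument \<open>m\<close>.\<close>
  have "\<forall>a :: nat \<Rightarrow> ('v, 'e) qpath \<Rightarrow>\<^sub>0 'f. (\<forall>i<N. Poly_Mapping.keys (a i) \<subseteq> qpaths Q) \<and>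
      (\<forall>i<N. m \<le> i \<longrightarrow> (\<exists>k\<in>qpaths Q. \<exists>c. a i = Poly_Mapping.single k c)) \<longrightarrow> ?S a = 0"
    if "m \<le> N" for m
    using that
  proof (induction m)
    case 0
    show ?case
    proof (intro allI impI, elim conjE)
      fix a :: "nat \<Rightarrow> ('v, 'e) qpath \<Rightarrow>\<^sub>0 'f"
      assume "\<forall>i<N. 0 \<le> i \<longrightarrow> (\<exists>k\<in>qpaths Q. \<exists>c. a i = Poly_Mapping.single k c)"
      then obtain k c where k: "\<And>i. i < N \<Longrightarrow> k i \<in> qpaths Q \<and> a i = Poly_Mapping.single (k i) (c i)"
        by (metis le0)
      then have "?S a = ?S (\<lambda>i. Poly_Mapping.single (k i) (c i))"
        by (intro cong) auto
      also have "\<dots> = 0"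
        using assms k by (intro standard_identity_on_paths) auto
      finally show "?S a = 0" .
    qed
  next
    case (Suc m)
    show ?case
    proof (intro allI impI, elim conjE)
      fix a :: "nat \<Rightarrow> ('v, 'e) qpath \<Rightarrow>\<^sub>0 'f"
      assume a: "\<forall>i<N. Poly_Mapping.keys (a i) \<subseteq> qpaths Q"
        and single: "\<forall>i<N. Suc m \<le> i \<longrightarrow> (\<exists>k\<in>qpaths Q. \<exists>c. a i = Poly_Mapping.single k c)"
      have mem: "m \<in> set (map \<sigma> [0..<N])" if "\<sigma> permutes {..<N}" for \<sigma>
        using letters[OF that] Suc.prems by (simp add: lessThan_iff)
      \<comment> \<open>With the other arguments fixed, argument \<open>m\<close> is expanded into
        single terms. Each of these falls under the induction hypothesis, and additivity recombines
        them.\<close>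
      have "?S (a(m := f)) = 0" if "Poly_Mapping.keys f \<subseteq> qpaths Q" for f
      proof (induction f rule: path_comb_induct)
        case zero
        show ?case using mem by (intro sum.neutral) (auto simp: monomial_value_zero[where j = m] simp del: set_map)
      next
        case (single k c)
        with that have "k \<in> qpaths Q" by blast
        then show ?case
          using Suc a \<open>\<forall>i<N. Suc m \<le> i \<longrightarrow> _\<close>
          by (intro Suc.IH[rule_format]) (auto simp: le_Suc_eq Suc_le_eq)
      next
        case (add g h)
        have "?S (a(m := g + h)) = ?S (a(m := g)) + ?S (a(m := h))"
          unfolding sum.distrib[symmetric]
          using mem distinct
          by (intro sum.cong) (auto simp: monomial_value_add scale_add simp del: set_map)
        then show ?case using add by (simp del: fun_upd_apply)
      qed
      from this[of "a m"] show "?S a = 0"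
        using a Suc.prems by simp
    qed
  qed
  from this[of N] show ?thesis
    using assms(4) by auto
qed

theorem theorem1p1:
  fixes Q :: "('v, 'e) pre_digraph"
  assumes "fin_digraph Q"
  shows "PI_algebra (path_algebra Q :: ('f::field, ('v, 'e) qpath \<Rightarrow>\<^sub>0 'f) module)
    \<longleftrightarrow> (\<forall>v \<in> verts Q. \<exists>\<^sub>\<le>\<^sub>1 C. oriented_cycle Q C \<and> v \<in> verts C)"
proof (intro iffI ballI)
  interpret fin_digraph Q by fact
  fix v
  assume PI: "PI_algebra (path_algebra Q :: ('f, ('v, 'e) qpath \<Rightarrow>\<^sub>0 'f) module)"
  show "\<exists>\<^sub>\<le>\<^sub>1 C. oriented_cycle Q C \<and> v \<in> verts C"
    unfolding Uniq_def
  proof (intro allI impI, elim conjE)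
    fix C D assume "oriented_cycle Q C" "v \<in> verts C" "oriented_cycle Q D" "v \<in> verts D"
    then obtain p q where p: "awalk v p v" "p \<noteq> []" "C = path_support Q p"
      and q: "awalk v q v" "q \<noteq> []" "D = path_support Q q"
      by (meson oriented_cycle_closed_walk)
    have "p @ q = q @ p"
      using not_PI_path_algebra[OF assms p(1) q(1)] PI by blast
    then have "set p = set q"
      using p(2) q(2) by (rule commuting_words_same_letters)
    \<comment> \<open>Equal arrow sets already give equal supports, since vertices and incidences
      are inherited from \<open>Q\<close>.\<close>
    then show "D = C"
      by (simp add: p(3) q(3) path_support_def)
  qed
next
  assume unique: "\<forall>v \<in> verts Q. \<exists>\<^sub>\<le>\<^sub>1 C. oriented_cycle Q C \<and> v \<in> verts C"
  let ?A = "path_algebra Q :: ('f, ('v, 'e) qpath \<Rightarrow>\<^sub>0 'f) module"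
  let ?N = "Suc ((card (verts Q))\<^sup>2)"
  have "nc_eval ?A (standard_polynomial ?N) a = \<zero>\<^bsub>?A\<^esub>" if "\<forall>i<?N. a i \<in> carrier ?A" for a
    using that standard_identity[OF assms unique, of ?N a]
    by (subst nc_eval_standard_polynomial[OF assms]) simp_all
  then show "PI_algebra ?A"
    unfolding PI_algebra_def
    using assoc_algebra_path_algebra[OF assms] standard_polynomial_in_nc_polynomials
      standard_polynomial_nonzero by blast
qed

end
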